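(* There exists a functor $(\cdot)^{\natural}$ from $\mathsf{RCCat}$ to $\mathsf{GCCat}$, sending a Riguet classified category $(\mathsf{C},\Phi)$ to $(\mathsf{C},\Phi^{\natural})$ and a morphism $F$ to $F$, whose image is contained in $\mathsf{SGCCat}$. Moreover, the corestriction of $(\cdot)^{\natural}$ to $\mathsf{SGCCat}$ has a right adjoint $(\cdot)^{\flat}$, sending $(\mathsf{C},\Psi)$ to $(\mathsf{C},\Psi^{\flat})$ and a morphism $F$ to $F$.
   Context: A Riguet congruence on a category $\mathsf{C}$ is a pair $\Phi=(\Phi^{\mathrm{ob}},\Phi^{\mathrm{fl}})$ where $\Phi^{\mathrm{ob}}$ is an equivalence relation on $\mathrm{Ob}(\mathsf{C})$ and $\Phi^{\mathrm{fl}}$ assigns to all $(a,a'),(b,b')\in\Phi^{\mathrm{ob}}$ a subset $\Phi^{\mathrm{fl}}_{\left(\begin{smallmatrix}a&b\\ a'&b'\end{smallmatrix}\right)}\subseteq\mathrm{Hom}_{\mathsf{C}}(a,b)\times\mathrm{Hom}_{\mathsf{C}}(a',b')$ such that: (Ra) if $(a,b)\in\Phi^{\mathrm{ob}}$, then $(\mathrm{id}_a,\mathrm{id}_b)\in\Phi^{\mathrm{fl}}_{\left(\begin{smallmatrix}a&a\\ b&b\end{smallmatrix}\right)}$; (Rb) if $f\in\mathrm{Hom}_{\mathsf{C}}(a,b)$, then $(f,f)\in\Phi^{\mathrm{fl}}_{\left(\begin{smallmatrix}a&b\\ a&b\end{smallmatrix}\right)}$; (Rc) if $(f,f')\in\Phi^{\mathrm{fl}}_{\left(\begin{smallmatrix}a&b\\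 a'&b'\end{smallmatrix}\right)}$, then $(f',f)\in\Phi^{\mathrm{fl}}_{\left(\begin{smallmatrix}a'&b'\\ a&b\end{smallmatrix}\right)}$; (Rd) if $(f,f')\in\Phi^{\mathrm{fl}}_{\left(\begin{smallmatrix}a&b\\ a'&b'\end{smallmatrix}\right)}$ and $(f',f'')\in\Phi^{\mathrm{fl}}_{\left(\begin{smallmatrix}a'&b'\\ a''&b''\end{smallmatrix}\right)}$, then $(f,f'')\in\Phi^{\mathrm{fl}}_{\left(\begin{smallmatrix}a&b\\ a''&b''\end{smallmatrix}\right)}$; (Re) if $(f,f')\in\Phi^{\mathrm{fl}}_{\left(\begin{smallmatrix}a&b\\ a'&b'\end{smallmatrix}\right)}$ and $(g,g')\in\Phi^{\mathrm{fl}}_{\left(\begin{smallmatrix}b&c\\ b'&c'\end{smallmatrix}\right)}$, then $(g\circ f,g'\circ f')\in\Phi^{\mathrm{fl}}_{\left(\begin{smallmatrix}a&c\\ a'&c'\end{smallmatrix}\right)}$; (Rf) for all $(a,a'),(b,b')\in\Phi^{\mathrm{ob}}$ and $f\in\mathrm{Hom}_{\mathsf{C}}(a,b)$ there is $f'\in\mathrm{Hom}_{\mathsf{C}}(a',b')$ with $(f,f')\in\Phi^{\mathrm{fl}}_{\left(\begin{smallmatrix}a&b\\ a'&b'\end{smallmatrix}\right)}$. Let $\mathrm{sc}(f)$, $\mathrm{tg}(f)$ be the source and target of a morphism $f$, let $\mathrm{Mor}(\mathsf{C})^{+}$ be the set of finite nonempty sequences $(f_i)_{i\in m}=(f_0,\dots,f_{m-1})$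 of morphisms of $\mathsf{C}$, let $(f)$ be the length-one sequence, and let $\curlywedge$ be concatenation. For an equivalence relation $E$ on $\mathrm{Ob}(\mathsf{C})$, $\mathrm{Mor}(\mathsf{C})^{+}_{E}$ is the set of $E$-composable sequences: those $(f_i)_{i\in m}$ with $(\mathrm{tg}(f_i),\mathrm{sc}(f_{i+1}))\in E$ for every $i\in m-1$. A generalized congruence on $\mathsf{C}$ is a pair $\Psi=(\Psi^{\mathrm{ob}},\Psi^{\mathrm{fl}})$ where $\Psi^{\mathrm{ob}}$ is an equivalence relation on $\mathrm{Ob}(\mathsf{C})$ and $\Psi^{\mathrm{fl}}$ is an equivalence relation on $\mathrm{Mor}(\mathsf{C})^{+}_{\Psi^{\mathrm{ob}}}$ such that: (a) if $(a,b)\in\Psi^{\mathrm{ob}}$, then $((\mathrm{id}_a),(\mathrm{id}_b))\in\Psi^{\mathrm{fl}}$; (b) if $((f_i)_{i\in m},(g_j)_{j\in n})\in\Psi^{\mathrm{fl}}$, then $(\mathrm{sc}(f_0),\mathrm{sc}(g_0))\in\Psi^{\mathrm{ob}}$ and $(\mathrm{tg}(f_{m-1}),\mathrm{tg}(g_{n-1}))\in\Psi^{\mathrm{ob}}$; (c) if $\mathrm{sc}(g)=\mathrm{tg}(f)$, then $((f,g),(g\circ f))\in\Psi^{\mathrm{fl}}$; (d) if $((f_i)_{i\in m},(f'_{i'})_{i'\in m'}),((g_j)_{j\in n},(g'_{j'})_{j'\in n'})\in\Psi^{\mathrm{fl}}$ and $(\mathrm{tg}(f_{m-1}),\mathrm{sc}(g_0))\in\Psi^{\mathrm{ob}}$,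 then $((f_i)_{i\in m}\curlywedge(g_j)_{j\in n},(f'_{i'})_{i'\in m'}\curlywedge(g'_{j'})_{j'\in n'})\in\Psi^{\mathrm{fl}}$. $\Psi$ is strong if, for all $(a,a'),(b,b')\in\Psi^{\mathrm{ob}}$ and $f\in\mathrm{Hom}_{\mathsf{C}}(a,b)$, there is $f'\in\mathrm{Hom}_{\mathsf{C}}(a',b')$ with $((f),(f'))\in\Psi^{\mathrm{fl}}$. For a Riguet congruence $\Phi$ on $\mathsf{C}$, $\Phi^{\natural}$ is the smallest (for coordinatewise inclusion) generalized congruence $\Psi$ on $\mathsf{C}$ such that $\Phi^{\mathrm{ob}}\subseteq\Psi^{\mathrm{ob}}$ and $((f),(f'))\in\Psi^{\mathrm{fl}}$ whenever $(f,f')$ lies in some component of $\Phi^{\mathrm{fl}}$. For a strong generalized congruence $\Psi$ on $\mathsf{C}$, $\Psi^{\flat}$ is the Riguet congruence with $\Psi^{\flat\mathrm{ob}}=\Psi^{\mathrm{ob}}$ and $\Psi^{\flat\mathrm{fl}}_{\left(\begin{smallmatrix}a&b\\ a'&b'\end{smallmatrix}\right)}=\{(f,f')\in\mathrm{Hom}_{\mathsf{C}}(a,b)\times\mathrm{Hom}_{\mathsf{C}}(a',b')\mid((f),(f'))\in\Psi^{\mathrm{fl}}\}$. $\mathsf{RCCat}$: objects are pairs $(\mathsf{C},\Phi)$ with $\mathsf{C}$ a category and $\Phi$ a Riguet congruence on $\mathsf{C}$ (Riguet classified categories); morphisms $(\mathsf{C},\Phi)\to(\mathsf{D},\Upsilon)$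 are functors $F\colon\mathsf{C}\to\mathsf{D}$ such that $(a,b)\in\Phi^{\mathrm{ob}}$ implies $(F(a),F(b))\in\Upsilon^{\mathrm{ob}}$, and $(f,f')\in\Phi^{\mathrm{fl}}_{\left(\begin{smallmatrix}a&b\\ a'&b'\end{smallmatrix}\right)}$ implies $(F(f),F(f'))\in\Upsilon^{\mathrm{fl}}_{\left(\begin{smallmatrix}F(a)&F(b)\\ F(a')&F(b')\end{smallmatrix}\right)}$. $\mathsf{GCCat}$: objects are pairs $(\mathsf{C},\Psi)$ with $\Psi$ a generalized congruence on $\mathsf{C}$; morphisms $(\mathsf{C},\Psi)\to(\mathsf{D},\Omega)$ are functors $F\colon\mathsf{C}\to\mathsf{D}$ such that $(a,b)\in\Psi^{\mathrm{ob}}$ implies $(F(a),F(b))\in\Omega^{\mathrm{ob}}$, and $((f_i)_{i\in m},(g_j)_{j\in n})\in\Psi^{\mathrm{fl}}$ implies $((F(f_i))_{i\in m},(F(g_j))_{j\in n})\in\Omega^{\mathrm{fl}}$. $\mathsf{SGCCat}$ is the full subcategory of $\mathsf{GCCat}$ of those $(\mathsf{C},\Psi)$ with $\Psi$ strong. *)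

theory Defs
  imports Main "HOL-Library.FuncSet"
begin

section \<open>Categories, functors, adjunctions\<close>

text \<open>
  A category has a set of objects and a set of morphisms, carved out of the types \<open>'o\<close> and \<open>'m\<close>;
  these types play the role of the ambient universe. All operations take the value
  \<^const>\<open>undefined\<close> outside their domains, so that equality of records is equality of
  categories. \<open>cmp C g f\<close> is the composite of \<open>f\<close> followed by \<open>g\<close>.
\<close>

record ('o, 'm) category =
  Ob :: "'o set"
  Mor :: "'m set"
  sc :: "'m \<Rightarrow> 'o"
  tg :: "'m \<Rightarrow> 'o"
  idt :: "'o \<Rightarrow> 'm"
  cmp :: "'m \<Rightarrow> 'm \<Rightarrow> 'm"

definition Hom :: "('o, 'm) category \<Rightarrow> 'o \<Rightarrow> 'o \<Rightarrow> 'm set" where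
  "Hom C a b = {f \<in> Mor C. sc C f = a \<and> tg C f = b}"

definition composable :: "('o, 'm) category \<Rightarrow> 'm \<Rightarrow> 'm \<Rightarrow> bool" where
  "composable C g f \<longleftrightarrow> f \<in> Mor C \<and> g \<in> Mor C \<and> sc C g = tg C f"

definition is_category :: "('o, 'm) category \<Rightarrow> bool" where
  "is_category C \<longleftrightarrow>
     sc C \<in> Mor C \<rightarrow>\<^sub>E Ob C \<and>
     tg C \<in> Mor C \<rightarrow>\<^sub>E Ob C \<and>
     idt C \<in> extensional (Ob C) \<and>
     (\<forall>a\<in>Ob C. idt C a \<in> Hom C a a) \<and>
     (\<forall>f g. composable C g f \<longrightarrow> cmp C g f \<in> Hom C (sc C f) (tg C g)) \<and>
     (\<forall>f g. \<not> composable C g f \<longrightarrow> cmp C g f = undefined) \<and>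
     (\<forall>f\<in>Mor C. cmp C f (idt C (sc C f)) = f \<and> cmp C (idt C (tg C f)) f = f) \<and>
     (\<forall>f g h. composable C g f \<and> composable C h g \<longrightarrow>
        cmp C h (cmp C g f) = cmp C (cmp C h g) f)"

text \<open>
  A functor is given by its object map and its morphism map, both \<^const>\<open>undefined\<close> outside
  the source category. Source and target are not part of these data but arguments of
  \<open>is_functor\<close>; in particular a functor and its corestriction to a subcategory of its target have
  the same underlying data.
\<close>

record ('o, 'm, 'p, 'n) functor_maps =
  fob :: "'o \<Rightarrow> 'p"
  fmor :: "'m \<Rightarrow> 'n"

definition is_functor ::
  "('o, 'm) category \<Rightarrow> ('p, 'n) category \<Rightarrow> ('o, 'm, 'p, 'n) functor_maps \<Rightarrow> bool" where
  "is_functor C D F \<longleftrightarrow>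
     is_category C \<and> is_category D \<and>
     fob F \<in> Ob C \<rightarrow>\<^sub>E Ob D \<and>
     fmor F \<in> Mor C \<rightarrow>\<^sub>E Mor D \<and>
     (\<forall>f\<in>Mor C. sc D (fmor F f) = fob F (sc C f) \<and> tg D (fmor F f) = fob F (tg C f)) \<and>
     (\<forall>a\<in>Ob C. fmor F (idt C a) = idt D (fob F a)) \<and>
     (\<forall>f g. composable C g f \<longrightarrow> fmor F (cmp C g f) = cmp D (fmor F g) (fmor F f))"

definition id_functor :: "('o, 'm) category \<Rightarrow> ('o, 'm, 'o, 'm) functor_maps" where
  "id_functor C = \<lparr>fob = (\<lambda>a\<in>Ob C. a), fmor = (\<lambda>f\<in>Mor C. f)\<rparr>"

definition comp_functor ::
  "('o, 'm) category \<Rightarrow> ('p, 'n, 'q, 'r) functor_maps \<Rightarrow> ('o, 'm, 'p, 'n) functor_maps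
    \<Rightarrow> ('o, 'm, 'q, 'r) functor_maps" where
  "comp_functor C G F =
     \<lparr>fob = (\<lambda>a\<in>Ob C. fob G (fob F a)), fmor = (\<lambda>f\<in>Mor C. fmor G (fmor F f))\<rparr>"

definition full_subcategory :: "('o, 'm) category \<Rightarrow> 'o set \<Rightarrow> ('o, 'm) category" where
  "full_subcategory C S =
     (let O' = Ob C \<inter> S; M' = {f \<in> Mor C. sc C f \<in> S \<and> tg C f \<in> S} in
      \<lparr>Ob = O', Mor = M', sc = restrict (sc C) M', tg = restrict (tg C) M',
       idt = restrict (idt C) O',
       cmp = (\<lambda>g f. if g \<in> M' \<and> f \<in> M' then cmp C g f else undefined)\<rparr>)"

text \<open>
  \<open>G\<close> is right adjoint to \<open>F\<close>: there are bijections \<open>Hom B (F a) b \<rightarrow> Hom A a (G b)\<close>,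
  natural in \<open>a\<close> and \<open>b\<close>.
\<close>

definition is_right_adjoint ::
  "('o, 'm) category \<Rightarrow> ('p, 'n) category \<Rightarrow>
   ('o, 'm, 'p, 'n) functor_maps \<Rightarrow> ('p, 'n, 'o, 'm) functor_maps \<Rightarrow> bool" where
  "is_right_adjoint A B F G \<longleftrightarrow>
     is_functor A B F \<and> is_functor B A G \<and>
     (\<exists>\<phi> :: 'o \<Rightarrow> 'p \<Rightarrow> 'n \<Rightarrow> 'm.
        (\<forall>a\<in>Ob A. \<forall>b\<in>Ob B. bij_betw (\<phi> a b) (Hom B (fob F a) b) (Hom A a (fob G b))) \<and>
        (\<forall>a\<in>Ob A. \<forall>a'\<in>Ob A. \<forall>b\<in>Ob B. \<forall>b'\<in>Ob B.
           \<forall>h\<in>Hom A a' a. \<forall>k\<in>Hom B b b'. \<forall>f\<in>Hom B (fob F a) b.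
             \<phi> a' b' (cmp B k (cmp B f (fmor F h))) =
             cmp A (fmor G k) (cmp A (\<phi> a b f) h)))"


section \<open>Riguet congruences\<close>

text \<open>
  \<open>rfl \<Phi> a b a' b'\<close> is the component at the matrix with rows \<open>(a, b)\<close> and \<open>(a', b')\<close>. It is
  only meaningful for \<open>(a, a'), (b, b')\<close> in \<open>rob \<Phi>\<close> and is required to be empty otherwise.
\<close>

record ('o, 'm) riguet =
  rob :: "('o \<times> 'o) set"
  rfl :: "'o \<Rightarrow> 'o \<Rightarrow> 'o \<Rightarrow> 'o \<Rightarrow> ('m \<times> 'm) set"

definition riguet_congruence :: "('o, 'm) category \<Rightarrow> ('o, 'm) riguet \<Rightarrow> bool" where
  "riguet_congruence C \<Phi> \<longleftrightarrow>
     equiv (Ob C) (rob \<Phi>) \<and>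
     (\<forall>a b a' b'. (a, a') \<in> rob \<Phi> \<and> (b, b') \<in> rob \<Phi> \<longrightarrow>
        rfl \<Phi> a b a' b' \<subseteq> Hom C a b \<times> Hom C a' b') \<and>
     (\<forall>a b a' b'. \<not> ((a, a') \<in> rob \<Phi> \<and> (b, b') \<in> rob \<Phi>) \<longrightarrow> rfl \<Phi> a b a' b' = {}) \<and>
     (\<forall>a b. (a, b) \<in> rob \<Phi> \<longrightarrow> (idt C a, idt C b) \<in> rfl \<Phi> a a b b) \<and>
     (\<forall>a\<in>Ob C. \<forall>b\<in>Ob C. \<forall>f\<in>Hom C a b. (f, f) \<in> rfl \<Phi> a b a b) \<and>
     (\<forall>a b a' b' f f'. (f, f') \<in> rfl \<Phi> a b a' b' \<longrightarrow> (f', f) \<in> rfl \<Phi> a' b' a b) \<and>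
     (\<forall>a b a' b' a'' b'' f f' f''.
        (f, f') \<in> rfl \<Phi> a b a' b' \<and> (f', f'') \<in> rfl \<Phi> a' b' a'' b'' \<longrightarrow>
        (f, f'') \<in> rfl \<Phi> a b a'' b'') \<and>
     (\<forall>a b c a' b' c' f f' g g'.
        (f, f') \<in> rfl \<Phi> a b a' b' \<and> (g, g') \<in> rfl \<Phi> b c b' c' \<longrightarrow>
        (cmp C g f, cmp C g' f') \<in> rfl \<Phi> a c a' c') \<and>
     (\<forall>a b a' b'. (a, a') \<in> rob \<Phi> \<and> (b, b') \<in> rob \<Phi> \<longrightarrow>
        (\<forall>f\<in>Hom C a b. \<exists>f'\<in>Hom C a' b'. (f, f') \<in> rfl \<Phi> a b a' b'))"


section \<open>Generalized congruences\<close>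

definition Mor_plus :: "('o, 'm) category \<Rightarrow> ('o \<times> 'o) set \<Rightarrow> 'm list set" where
  "Mor_plus C E =
     {fs. fs \<noteq> [] \<and> set fs \<subseteq> Mor C \<and>
          (\<forall>i. Suc i < length fs \<longrightarrow> (tg C (fs ! i), sc C (fs ! Suc i)) \<in> E)}"

record ('o, 'm) gencong =
  gob :: "('o \<times> 'o) set"
  gfl :: "('m list \<times> 'm list) set"

definition generalized_congruence :: "('o, 'm) category \<Rightarrow> ('o, 'm) gencong \<Rightarrow> bool" where
  "generalized_congruence C \<Psi> \<longleftrightarrow>
     equiv (Ob C) (gob \<Psi>) \<and>
     equiv (Mor_plus C (gob \<Psi>)) (gfl \<Psi>) \<and>
     (\<forall>a b. (a, b) \<in> gob \<Psi> \<longrightarrow> ([idt C a], [idt C b]) \<in> gfl \<Psi>) \<and>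
     (\<forall>fs gs. (fs, gs) \<in> gfl \<Psi> \<longrightarrow>
        (sc C (hd fs), sc C (hd gs)) \<in> gob \<Psi> \<and> (tg C (last fs), tg C (last gs)) \<in> gob \<Psi>) \<and>
     (\<forall>f\<in>Mor C. \<forall>g\<in>Mor C. sc C g = tg C f \<longrightarrow> ([f, g], [cmp C g f]) \<in> gfl \<Psi>) \<and>
     (\<forall>fs fs' gs gs'.
        (fs, fs') \<in> gfl \<Psi> \<and> (gs, gs') \<in> gfl \<Psi> \<and> (tg C (last fs), sc C (hd gs)) \<in> gob \<Psi> \<longrightarrow>
        (fs @ gs, fs' @ gs') \<in> gfl \<Psi>)"

definition strong :: "('o, 'm) category \<Rightarrow> ('o, 'm) gencong \<Rightarrow> bool" where
  "strong C \<Psi> \<longleftrightarrow>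
     (\<forall>a b a' b'. (a, a') \<in> gob \<Psi> \<and> (b, b') \<in> gob \<Psi> \<longrightarrow>
        (\<forall>f\<in>Hom C a b. \<exists>f'\<in>Hom C a' b'. ([f], [f']) \<in> gfl \<Psi>))"


section \<open>The assignments natural and flat on congruences\<close>

definition contains_riguet ::
  "('o, 'm) category \<Rightarrow> ('o, 'm) riguet \<Rightarrow> ('o, 'm) gencong \<Rightarrow> bool" where
  "contains_riguet C \<Phi> \<Psi> \<longleftrightarrow>
     generalized_congruence C \<Psi> \<and> rob \<Phi> \<subseteq> gob \<Psi> \<and>
     (\<forall>a b a' b' f f'. (a, a') \<in> rob \<Phi> \<and> (b, b') \<in> rob \<Phi> \<and> (f, f') \<in> rfl \<Phi> a b a' b' \<longrightarrow>
        ([f], [f']) \<in> gfl \<Psi>)"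

definition smallest_containing ::
  "('o, 'm) category \<Rightarrow> ('o, 'm) riguet \<Rightarrow> ('o, 'm) gencong \<Rightarrow> bool" where
  "smallest_containing C \<Phi> \<Psi> \<longleftrightarrow>
     contains_riguet C \<Phi> \<Psi> \<and>
     (\<forall>\<Psi>'. contains_riguet C \<Phi> \<Psi>' \<longrightarrow> gob \<Psi> \<subseteq> gob \<Psi>' \<and> gfl \<Psi> \<subseteq> gfl \<Psi>')"

text \<open>Existence and uniqueness are shown in \<open>natural_cong_smallest\<close> below.\<close>

definition natural_cong :: "('o, 'm) category \<Rightarrow> ('o, 'm) riguet \<Rightarrow> ('o, 'm) gencong" where
  "natural_cong C \<Phi> = (THE \<Psi>. smallest_containing C \<Phi> \<Psi>)"

definition flat_cong :: "('o, 'm) category \<Rightarrow> ('o, 'm) gencong \<Rightarrow> ('o, 'm) riguet" where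
  "flat_cong C \<Psi> =
     \<lparr>rob = gob \<Psi>,
      rfl = (\<lambda>a b a' b'. if (a, a') \<in> gob \<Psi> \<and> (b, b') \<in> gob \<Psi>
                         then {(f, f') \<in> Hom C a b \<times> Hom C a' b'. ([f], [f']) \<in> gfl \<Psi>}
                         else {})\<rparr>"


section \<open>The categories of classified categories\<close>

text \<open>
  Objects are pairs of a category and an additional structure on it; morphisms from \<open>X\<close> to \<open>Y\<close>
  are the functors between the underlying categories satisfying \<open>P X Y\<close>, stored with their source
  and target as \<open>(X, F, Y)\<close>.
\<close>

type_synonym ('o, 'm, 's) classified = "('o, 'm) category \<times> 's"

type_synonym ('o, 'm, 's) classified_mor =
  "('o, 'm, 's) classified \<times> ('o, 'm, 'o, 'm) functor_maps \<times> ('o, 'm, 's) classified"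

definition classified_cat ::
  "('o, 'm, 's) classified set \<Rightarrow>
   (('o, 'm, 's) classified \<Rightarrow> ('o, 'm, 's) classified \<Rightarrow> ('o, 'm, 'o, 'm) functor_maps \<Rightarrow> bool) \<Rightarrow>
   (('o, 'm, 's) classified, ('o, 'm, 's) classified_mor) category" where
  "classified_cat S P =
     (let M = {(X, F, Y). X \<in> S \<and> Y \<in> S \<and> is_functor (fst X) (fst Y) F \<and> P X Y F} in
      \<lparr>Ob = S, Mor = M,
       sc = (\<lambda>(X, F, Y)\<in>M. X),
       tg = (\<lambda>(X, F, Y)\<in>M. Y),
       idt = (\<lambda>X\<in>S. (X, id_functor (fst X), X)),
       cmp = (\<lambda>(Y', G, Z) (X, F, Y).
                if (Y', G, Z) \<in> M \<and> (X, F, Y) \<in> M \<and> Y' = Y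
                then (X, comp_functor (fst X) G F, Z) else undefined)\<rparr>)"

definition riguet_morphism ::
  "('o, 'm, ('o, 'm) riguet) classified \<Rightarrow> ('o, 'm, ('o, 'm) riguet) classified \<Rightarrow>
   ('o, 'm, 'o, 'm) functor_maps \<Rightarrow> bool" where
  "riguet_morphism = (\<lambda>(C, \<Phi>) (D, \<Upsilon>) F.
     (\<forall>a b. (a, b) \<in> rob \<Phi> \<longrightarrow> (fob F a, fob F b) \<in> rob \<Upsilon>) \<and>
     (\<forall>a b a' b' f f'. (f, f') \<in> rfl \<Phi> a b a' b' \<longrightarrow>
        (fmor F f, fmor F f') \<in> rfl \<Upsilon> (fob F a) (fob F b) (fob F a') (fob F b')))"

definition gencong_morphism ::
  "('o, 'm, ('o, 'm) gencong) classified \<Rightarrow> ('o, 'm, ('o, 'm) gencong) classified \<Rightarrow>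
   ('o, 'm, 'o, 'm) functor_maps \<Rightarrow> bool" where
  "gencong_morphism = (\<lambda>(C, \<Psi>) (D, \<Omega>) F.
     (\<forall>a b. (a, b) \<in> gob \<Psi> \<longrightarrow> (fob F a, fob F b) \<in> gob \<Omega>) \<and>
     (\<forall>fs gs. (fs, gs) \<in> gfl \<Psi> \<longrightarrow> (map (fmor F) fs, map (fmor F) gs) \<in> gfl \<Omega>))"

type_synonym ('o, 'm) rccat =
  "(('o, 'm, ('o, 'm) riguet) classified, ('o, 'm, ('o, 'm) riguet) classified_mor) category"

type_synonym ('o, 'm) gccat =
  "(('o, 'm, ('o, 'm) gencong) classified, ('o, 'm, ('o, 'm) gencong) classified_mor) category"

definition RCCat :: "('o, 'm) rccat" where
  "RCCat = classified_cat {(C, \<Phi>). is_category C \<and> riguet_congruence C \<Phi>} riguet_morphism"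

definition GCCat :: "('o, 'm) gccat" where
  "GCCat = classified_cat {(C, \<Psi>). is_category C \<and> generalized_congruence C \<Psi>} gencong_morphism"

definition SGCCat :: "('o, 'm) gccat" where
  "SGCCat = full_subcategory GCCat {(C, \<Psi>). strong C \<Psi>}"


section \<open>Well-definedness of the natural congruence\<close>

lemma Mor_plus_Inter:
  assumes "I \<noteq> {}"
  shows "Mor_plus C (\<Inter>i\<in>I. E i) = (\<Inter>i\<in>I. Mor_plus C (E i))"
  using assms unfolding Mor_plus_def by auto

lemma equiv_Inter:
  assumes "I \<noteq> {}" and "\<And>i. i \<in> I \<Longrightarrow> equiv (A i) (r i)"
  shows "equiv (\<Inter>i\<in>I. A i) (\<Inter>i\<in>I. r i)"
proof (rule equivI)
  have "r i \<subseteq> A i \<times> A i" if "i \<in> I" for i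
    using assms(2)[OF that] unfolding equiv_def by simp
  then show "(\<Inter>i\<in>I. r i) \<subseteq> (\<Inter>i\<in>I. A i) \<times> (\<Inter>i\<in>I. A i)"
    by fast
  have r: "refl_on (A i) (r i)" if "i \<in> I" for i
    using assms(2)[OF that] unfolding equiv_def by simp
  show "refl_on (\<Inter>i\<in>I. A i) (\<Inter>i\<in>I. r i)"
    by (intro refl_onI INT_I) (auto intro: refl_onD[OF r])
  have *: "sym (r i)" "trans (r i)" if "i \<in> I" for i
    using assms(2)[OF that] unfolding equiv_def by simp_all
  show "sym (\<Inter>i\<in>I. r i)"
    using symD[OF *(1)] by (intro symI INT_I) blast
  show "trans (\<Inter>i\<in>I. r i)"
  proof (intro transI INT_I)
    fix x y z i
    assume "(x, y) \<in> (\<Inter>i\<in>I. r i)" "(y, z) \<in> (\<Inter>i\<in>I. r i)" and i: "i \<in> I"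
    then have "(x, y) \<in> r i" "(y, z) \<in> r i" by simp_all
    with *(2)[OF i] show "(x, z) \<in> r i" by (rule transD)
  qed
qed

lemma contains_riguet_total:
  assumes C: "is_category C" and R: "riguet_congruence C \<Phi>"
  shows "contains_riguet C \<Phi>
    \<lparr>gob = Ob C \<times> Ob C, gfl = Mor_plus C (Ob C \<times> Ob C) \<times> Mor_plus C (Ob C \<times> Ob C)\<rparr>"
proof -
  have st: "sc C f \<in> Ob C" "tg C f \<in> Ob C" if "f \<in> Mor C" for f
    using C that unfolding is_category_def by auto
  have M: "Mor_plus C (Ob C \<times> Ob C) = {fs. fs \<noteq> [] \<and> set fs \<subseteq> Mor C}"
    unfolding Mor_plus_def using st by (auto simp: subset_iff)
  have eq: "equiv A (A \<times> A)" for A :: "'x set"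
    by (auto simp: equiv_def refl_on_def sym_def trans_def)
  have i: "idt C a \<in> Mor C" if "a \<in> Ob C" for a
    using C that unfolding is_category_def Hom_def by auto
  have c: "cmp C g f \<in> Mor C" if "f \<in> Mor C" "g \<in> Mor C" "sc C g = tg C f" for f g
    using C that unfolding is_category_def Hom_def composable_def by auto
  have hl: "hd fs \<in> Mor C" "last fs \<in> Mor C" if "fs \<noteq> []" "set fs \<subseteq> Mor C" for fs
    using that by (auto simp: subset_iff)
  have "generalized_congruence C
    \<lparr>gob = Ob C \<times> Ob C, gfl = Mor_plus C (Ob C \<times> Ob C) \<times> Mor_plus C (Ob C \<times> Ob C)\<rparr>"
    unfolding generalized_congruence_def by (auto simp: eq M i c st hl)
  moreover have "rob \<Phi> \<subseteq> Ob C \<times> Ob C"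
    using R unfolding riguet_congruence_def equiv_def by (elim conjE)
  moreover have "f \<in> Mor C \<and> f' \<in> Mor C"
    if "(a, a') \<in> rob \<Phi>" "(b, b') \<in> rob \<Phi>" "(f, f') \<in> rfl \<Phi> a b a' b'" for a b a' b' f f'
  proof -
    have "rfl \<Phi> a b a' b' \<subseteq> Hom C a b \<times> Hom C a' b'"
      using R[unfolded riguet_congruence_def, THEN conjunct2, THEN conjunct1] that(1,2) by blast
    with that(3) show ?thesis unfolding Hom_def by blast
  qed
  ultimately show ?thesis
    unfolding contains_riguet_def M by (simp, meson)
qed

lemma natural_cong_smallest:
  assumes "is_category C" and "riguet_congruence C \<Phi>"
  shows "smallest_containing C \<Phi> (natural_cong C \<Phi>)"
proof -
  define I where "I = {\<Psi>. contains_riguet C \<Phi> \<Psi>}"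
  define N :: "('a, 'b) gencong" where
    "N = \<lparr>gob = (\<Inter>\<Psi>\<in>I. gob \<Psi>), gfl = (\<Inter>\<Psi>\<in>I. gfl \<Psi>)\<rparr>"
  have ne: "I \<noteq> {}" using contains_riguet_total[OF assms] unfolding I_def by blast
  have g: "generalized_congruence C \<Psi>" if "\<Psi> \<in> I" for \<Psi>
    using that unfolding I_def contains_riguet_def by blast
  have e1: "equiv (Ob C) (gob N)"
    using equiv_Inter[OF ne, of "\<lambda>_. Ob C" gob] g ne
    unfolding N_def generalized_congruence_def by simp
  have e2: "equiv (Mor_plus C (gob N)) (gfl N)"
    using equiv_Inter[OF ne, of "\<lambda>\<Psi>. Mor_plus C (gob \<Psi>)" gfl] g
    unfolding N_def generalized_congruence_def by (simp add: Mor_plus_Inter[OF ne])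
  have "generalized_congruence C N"
    unfolding generalized_congruence_def
    using e1 e2 g unfolding N_def generalized_congruence_def by simp
  hence "contains_riguet C \<Phi> N"
    unfolding contains_riguet_def N_def I_def by simp blast
  hence s: "smallest_containing C \<Phi> N"
    unfolding smallest_containing_def N_def I_def by simp blast
  have "\<Psi> = N" if "smallest_containing C \<Phi> \<Psi>" for \<Psi>
  proof (rule gencong.equality)
    have "gob \<Psi> \<subseteq> gob N \<and> gfl \<Psi> \<subseteq> gfl N" "gob N \<subseteq> gob \<Psi> \<and> gfl N \<subseteq> gfl \<Psi>"
      using that s unfolding smallest_containing_def by blast+
    then show "gob \<Psi> = gob N" "gfl \<Psi> = gfl N" by blast+
  qed simp
  with s show ?thesis
    unfolding natural_cong_def by (rule theI)
qed

end

theory Submission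
  imports Defs
begin

text \<open>
  Everything follows from a description of the morphisms out of a natural congruence. Let
  \<open>F\<close> be a functor from \<open>C\<close> to \<open>D\<close>, \<open>\<Phi>\<close> a Riguet congruence on \<open>C\<close> and \<open>\<Omega>\<close> a generalized
  congruence on \<open>D\<close>. The pairs of objects and of sequences in \<open>C\<close> whose images are related by \<open>\<Omega>\<close>
  form a generalized congruence on \<open>C\<close> (\<open>pullback_cong_is_generalized_congruence\<close>). As the natural
  congruence is the smallest one containing \<open>\<Phi>\<close>, the functor \<open>F\<close> respects it as soon as \<open>F\<close> sends
  the generators, that is the pairs of objects and of single morphisms related by \<open>\<Phi>\<close>, into \<open>\<Omega>\<close>
  (\<open>gencong_morphism_natural_iff\<close>).

  Applied to \<open>\<Omega>\<close> the natural congruence on the target, this makes natural functorial. For strong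
  \<open>\<Omega>\<close>, the condition on generators says precisely that \<open>F\<close> is a morphism of Riguet classified
  categories into \<open>D\<close> with the flat of \<open>\<Omega>\<close> (\<open>riguet_morphism_flat_iff\<close>). Hence the same functors
  underlie both hom-sets of the adjunction, and naturality of the bijection is immediate
  (\<open>relabel_right_adjoint\<close>).

  It remains to see that natural takes strong values. The coarse relation that only compares the
  endpoints of sequences is a generalized congruence with the objects of \<open>\<Phi>\<close> identified and no
  others. It contains \<open>\<Phi>\<close>, so the natural congruence has the same object part as \<open>\<Phi>\<close>
  (\<open>gob_natural_cong\<close>), and strength is then the lifting axiom of \<open>\<Phi>\<close>
  (\<open>strong_natural_cong\<close>).
\<close>

section \<open>Functors\<close>

lemma is_categoryD:
  assumes "is_category C"
  shows "f \<in> Mor C \<Longrightarrow> sc C f \<in> Ob C"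
    and "f \<in> Mor C \<Longrightarrow> tg C f \<in> Ob C"
    and "a \<in> Ob C \<Longrightarrow> idt C a \<in> Hom C a a"
    and "composable C g f \<Longrightarrow> cmp C g f \<in> Hom C (sc C f) (tg C g)"
  using assms unfolding is_category_def by auto

lemma is_functorD:
  assumes "is_functor C D F"
  shows "is_category C" and "is_category D"
    and "fob F \<in> extensional (Ob C)" and "fmor F \<in> extensional (Mor C)"
    and "a \<in> Ob C \<Longrightarrow> fob F a \<in> Ob D"
    and "f \<in> Mor C \<Longrightarrow> fmor F f \<in> Mor D"
    and "f \<in> Mor C \<Longrightarrow> sc D (fmor F f) = fob F (sc C f)"
    and "f \<in> Mor C \<Longrightarrow> tg D (fmor F f) = fob F (tg C f)"
    and "a \<in> Ob C \<Longrightarrow> fmor F (idt C a) = idt D (fob F a)"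
    and "composable C g f \<Longrightarrow> fmor F (cmp C g f) = cmp D (fmor F g) (fmor F f)"
  using assms unfolding is_functor_def PiE_def by auto

lemma functor_composable:
  assumes "is_functor C D F" and "composable C g f"
  shows "composable D (fmor F g) (fmor F f)"
  using assms is_functorD(6-8)[OF assms(1)] unfolding composable_def by auto

lemma functor_Hom:
  assumes "is_functor C D F" and "f \<in> Hom C a b"
  shows "fmor F f \<in> Hom D (fob F a) (fob F b)"
  using assms(2) is_functorD(6-8)[OF assms(1)] unfolding Hom_def by auto

lemma id_functor_is_functor:
  assumes "is_category C"
  shows "is_functor C C (id_functor C)"
  using assms is_categoryD[OF assms]
  unfolding is_functor_def id_functor_def by (auto simp: composable_def Hom_def)

lemma comp_functor_is_functor:
  assumes F: "is_functor C D F" and G: "is_functor D E G"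
  shows "is_functor C E (comp_functor C G F)"
proof -
  note f = is_functorD[OF F] and g = is_functorD[OF G]
  have m: "cmp C h k \<in> Mor C" "h \<in> Mor C" "k \<in> Mor C" if "composable C h k" for h k
    using is_categoryD(4)[OF f(1) that] that unfolding Hom_def composable_def by auto
  have i: "idt C a \<in> Mor C" if "a \<in> Ob C" for a
    using is_categoryD(3)[OF f(1) that] unfolding Hom_def by auto
  show ?thesis
    unfolding is_functor_def comp_functor_def
    using f(1) g(2)
    by (auto simp: f(5-10) g(5-10) m i is_categoryD[OF f(1)] functor_composable[OF F])
qed

lemma comp_functor_id:
  assumes "is_functor C D F"
  shows "comp_functor C F (id_functor C) = F" and "comp_functor C (id_functor D) F = F"
  using is_functorD(3-6)[OF assms]
  by (auto intro!: functor_maps.equality extensionalityI[of _ "Ob C"] extensionalityI[of _ "Mor C"]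
      simp: comp_functor_def id_functor_def)

lemma comp_functor_assoc:
  assumes "is_functor C D F"
  shows "comp_functor C H (comp_functor C G F) = comp_functor C (comp_functor D H G) F"
  using is_functorD(5,6)[OF assms]
  by (auto intro!: functor_maps.equality ext simp: comp_functor_def restrict_def)


section \<open>Categories of classified categories\<close>

text \<open>
  Exactly what makes the functors singled out by \<open>P\<close> a category over the objects in \<open>S\<close>.
\<close>

definition admissible ::
  "('o, 'm, 's) classified set \<Rightarrow>
   (('o, 'm, 's) classified \<Rightarrow> ('o, 'm, 's) classified \<Rightarrow> ('o, 'm, 'o, 'm) functor_maps \<Rightarrow> bool)
   \<Rightarrow> bool" where
  "admissible S P \<longleftrightarrow>
     (\<forall>X\<in>S. is_category (fst X) \<and> P X X (id_functor (fst X))) \<and>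
     (\<forall>X\<in>S. \<forall>Y\<in>S. \<forall>Z\<in>S. \<forall>F G.
        is_functor (fst X) (fst Y) F \<and> P X Y F \<and> is_functor (fst Y) (fst Z) G \<and> P Y Z G \<longrightarrow>
        P X Z (comp_functor (fst X) G F))"

lemma admissibleI:
  assumes "\<And>C s. (C, s) \<in> S \<Longrightarrow> is_category C"
    and "\<And>C s. (C, s) \<in> S \<Longrightarrow> P (C, s) (C, s) (id_functor C)"
    and "\<And>C s D t E u F G. (C, s) \<in> S \<Longrightarrow> P (C, s) (D, t) F \<Longrightarrow> P (D, t) (E, u) G \<Longrightarrow>
      P (C, s) (E, u) (comp_functor C G F)"
  shows "admissible S P"
  unfolding admissible_def
proof (intro conjI ballI allI impI)
  fix X assume "X \<in> S"
  then show "is_category (fst X)" "P X X (id_functor (fst X))"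
    using assms(1,2)[of "fst X" "snd X"] by simp_all
next
  fix X Y Z F G
  assume "X \<in> S" "is_functor (fst X) (fst Y) F \<and> P X Y F \<and> is_functor (fst Y) (fst Z) G \<and> P Y Z G"
  then show "P X Z (comp_functor (fst X) G F)"
    using assms(3)[of "fst X" "snd X" "fst Y" "snd Y" F "fst Z" "snd Z" G] by simp
qed

lemma admissible_subset: "admissible S P \<Longrightarrow> S' \<subseteq> S \<Longrightarrow> admissible S' P"
  unfolding admissible_def subset_iff by blast

lemma Ob_classified_cat [simp]: "Ob (classified_cat S P) = S"
  by (simp add: classified_cat_def Let_def)

lemma Mor_classified_cat:
  "(X, F, Y) \<in> Mor (classified_cat S P) \<longleftrightarrow>
     X \<in> S \<and> Y \<in> S \<and> is_functor (fst X) (fst Y) F \<and> P X Y F"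
  by (simp add: classified_cat_def Let_def)

lemma sc_classified_cat:
  "(X, F, Y) \<in> Mor (classified_cat S P) \<Longrightarrow> sc (classified_cat S P) (X, F, Y) = X"
  by (simp add: classified_cat_def Let_def)

lemma tg_classified_cat:
  "(X, F, Y) \<in> Mor (classified_cat S P) \<Longrightarrow> tg (classified_cat S P) (X, F, Y) = Y"
  by (simp add: classified_cat_def Let_def)

lemma sc_tg_extensional:
  "sc (classified_cat S P) \<in> extensional (Mor (classified_cat S P))"
  "tg (classified_cat S P) \<in> extensional (Mor (classified_cat S P))"
  by (simp_all add: classified_cat_def Let_def)

lemma idt_classified_cat:
  "idt (classified_cat S P) = (\<lambda>X\<in>S. (X, id_functor (fst X), X))"
  by (simp add: classified_cat_def Let_def)

lemma composable_classified_cat: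
  "composable (classified_cat S P) (Y', G, Z) (X, F, Y) \<longleftrightarrow>
     (X, F, Y) \<in> Mor (classified_cat S P) \<and> (Y', G, Z) \<in> Mor (classified_cat S P) \<and> Y' = Y"
  by (auto simp: composable_def sc_classified_cat tg_classified_cat)

lemma cmp_classified_cat_if:
  "cmp (classified_cat S P) (Y', G, Z) (X, F, Y) =
     (if composable (classified_cat S P) (Y', G, Z) (X, F, Y)
      then (X, comp_functor (fst X) G F, Z) else undefined)"
  unfolding composable_classified_cat by (auto simp: classified_cat_def Let_def)

lemma cmp_classified_cat:
  "(X, F, Y) \<in> Mor (classified_cat S P) \<Longrightarrow> (Y, G, Z) \<in> Mor (classified_cat S P) \<Longrightarrow>
   cmp (classified_cat S P) (Y, G, Z) (X, F, Y) = (X, comp_functor (fst X) G F, Z)"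
  by (simp add: cmp_classified_cat_if composable_classified_cat)

lemma cmp_classified_cat_undefined:
  "\<not> composable (classified_cat S P) g f \<Longrightarrow> cmp (classified_cat S P) g f = undefined"
  by (cases g; cases f) (simp add: cmp_classified_cat_if)

lemma Hom_classified_cat:
  "Hom (classified_cat S P) X Y = {(X, F, Y) |F. (X, F, Y) \<in> Mor (classified_cat S P)}"
  by (auto simp: Hom_def sc_classified_cat tg_classified_cat)

lemma comp_functor_in_Mor:
  assumes "admissible S P"
    and "(X, F, Y) \<in> Mor (classified_cat S P)" and "(Y, G, Z) \<in> Mor (classified_cat S P)"
    and "fst X = C"
  shows "(X, comp_functor C G F, Z) \<in> Mor (classified_cat S P)"
  using assms(1-3) unfolding assms(4)[symmetric] Mor_classified_cat admissible_def
  by (metis comp_functor_is_functor)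

lemma classified_cat_is_category:
  assumes A: "admissible S P"
  shows "is_category (classified_cat S P)"
proof -
  let ?C = "classified_cat S P"
  have id: "(X, id_functor (fst X), X) \<in> Mor ?C" if "X \<in> S" for X
    using A that id_functor_is_functor unfolding Mor_classified_cat admissible_def by blast
  have "sc ?C \<in> Mor ?C \<rightarrow>\<^sub>E Ob ?C" "tg ?C \<in> Mor ?C \<rightarrow>\<^sub>E Ob ?C"
    using sc_tg_extensional[of S P]
    by (auto simp: PiE_def sc_classified_cat tg_classified_cat Mor_classified_cat)
  moreover have "idt ?C \<in> extensional (Ob ?C)"
    by (simp add: idt_classified_cat)
  moreover have "\<forall>a\<in>Ob ?C. idt ?C a \<in> Hom ?C a a"
    by (simp add: idt_classified_cat Hom_classified_cat id)
  moreover have "\<forall>f g. composable ?C g f \<longrightarrow> cmp ?C g f \<in> Hom ?C (sc ?C f) (tg ?C g)"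
    by (auto simp: composable_classified_cat cmp_classified_cat Hom_classified_cat
        sc_classified_cat tg_classified_cat intro!: comp_functor_in_Mor[OF A])
  moreover have "\<forall>f g. \<not> composable ?C g f \<longrightarrow> cmp ?C g f = undefined"
    by (simp add: cmp_classified_cat_undefined)
  moreover have "\<forall>f\<in>Mor ?C. cmp ?C f (idt ?C (sc ?C f)) = f \<and> cmp ?C (idt ?C (tg ?C f)) f = f"
  proof (clarify)
    fix X F Y assume f: "(X, F, Y) \<in> Mor ?C"
    then have "X \<in> S" "Y \<in> S" "is_functor (fst X) (fst Y) F" by (auto simp: Mor_classified_cat)
    then show "cmp ?C (X, F, Y) (idt ?C (sc ?C (X, F, Y))) = (X, F, Y) \<and>
        cmp ?C (idt ?C (tg ?C (X, F, Y))) (X, F, Y) = (X, F, Y)"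
      using f by (simp add: sc_classified_cat tg_classified_cat idt_classified_cat
          cmp_classified_cat id comp_functor_id)
  qed
  moreover have "\<forall>f g h. composable ?C g f \<and> composable ?C h g \<longrightarrow>
      cmp ?C h (cmp ?C g f) = cmp ?C (cmp ?C h g) f"
  proof (clarify)
    fix X F Y Y' G Z Z' H W
    assume "composable ?C (Y', G, Z) (X, F, Y)" "composable ?C (Z', H, W) (Y', G, Z)"
    then have eq: "Y' = Y" "Z' = Z"
      and m: "(X, F, Y) \<in> Mor ?C" "(Y, G, Z) \<in> Mor ?C" "(Z, H, W) \<in> Mor ?C"
      by (auto simp: composable_classified_cat)
    have "is_functor (fst X) (fst Y) F" using m(1) by (simp add: Mor_classified_cat)
    then show "cmp ?C (Z', H, W) (cmp ?C (Y', G, Z) (X, F, Y)) =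
        cmp ?C (cmp ?C (Z', H, W) (Y', G, Z)) (X, F, Y)"
      unfolding eq using m
      by (simp add: cmp_classified_cat comp_functor_in_Mor[OF A] comp_functor_assoc)
  qed
  ultimately show ?thesis unfolding is_category_def by blast
qed

text \<open>
  Equality of records, so that the full subcategory of strong generalized congruences is again a
  category of classified categories and falls under the lemmas on \<open>relabel\<close> below.
\<close>

lemma full_subcategory_classified_cat:
  "full_subcategory (classified_cat S P) T = classified_cat (S \<inter> T) P"
proof (rule category.equality)
  let ?C = "classified_cat S P" and ?D = "classified_cat (S \<inter> T) P"
  let ?B = "full_subcategory ?C T"
  show "Ob ?B = Ob ?D" by (simp add: full_subcategory_def Let_def)
  have M: "{f \<in> Mor ?C. sc ?C f \<in> T \<and> tg ?C f \<in> T} = Mor ?D"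
    by (auto simp: Mor_classified_cat sc_classified_cat tg_classified_cat)
  have B: "?B = \<lparr>Ob = S \<inter> T, Mor = Mor ?D, sc = restrict (sc ?C) (Mor ?D),
      tg = restrict (tg ?C) (Mor ?D), idt = restrict (idt ?C) (S \<inter> T),
      cmp = (\<lambda>g f. if g \<in> Mor ?D \<and> f \<in> Mor ?D then cmp ?C g f else undefined)\<rparr>"
    unfolding full_subcategory_def Let_def M by simp
  show "Mor ?B = Mor ?D" by (simp add: B)
  have sub: "(X, F, Y) \<in> Mor ?C" if "(X, F, Y) \<in> Mor ?D" for X F Y
    using that by (simp add: Mor_classified_cat)
  show "sc ?B = sc ?D"
    by (rule extensionalityI[of _ "Mor ?D"])
      (auto simp: B sc_tg_extensional sc_classified_cat sub)
  show "tg ?B = tg ?D"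
    by (rule extensionalityI[of _ "Mor ?D"])
      (auto simp: B sc_tg_extensional tg_classified_cat sub)
  show "idt ?B = idt ?D" by (auto simp: B idt_classified_cat)
  show "cmp ?B = cmp ?D"
  proof (intro ext)
    fix g f :: "('a, 'b, 'c) classified_mor"
    obtain X F Y where f: "f = (X, F, Y)" by (cases f)
    obtain Y' G Z where g: "g = (Y', G, Z)" by (cases g)
    show "cmp ?B g f = cmp ?D g f"
    proof (cases "composable ?D g f")
      case True
      then have eq: "Y' = Y" and m: "(X, F, Y) \<in> Mor ?D" "(Y, G, Z) \<in> Mor ?D"
        unfolding f g composable_classified_cat by auto
      then show ?thesis unfolding f g eq using sub[OF m(1)] sub[OF m(2)]
        by (simp add: B cmp_classified_cat)
    next
      case False
      have "cmp ?C g f = undefined" if "g \<in> Mor ?D" "f \<in> Mor ?D"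
        using False that unfolding f g
        by (auto simp: composable_classified_cat intro!: cmp_classified_cat_undefined)
      then show ?thesis using False by (simp add: B cmp_classified_cat_undefined)
    qed
  qed
qed simp

text \<open>
  Both functors of the adjunction only replace the structure on a category and leave underlying
  functors alone; \<open>relabel\<close> is the functor determined by such a replacement \<open>T\<close> of objects.
\<close>

definition relabel ::
  "('o, 'm, 's) classified set \<Rightarrow>
   (('o, 'm, 's) classified \<Rightarrow> ('o, 'm, 's) classified \<Rightarrow> ('o, 'm, 'o, 'm) functor_maps \<Rightarrow> bool) \<Rightarrow>
   (('o, 'm, 's) classified \<Rightarrow> ('o, 'm, 't) classified) \<Rightarrow>
   (('o, 'm, 's) classified, ('o, 'm, 's) classified_mor,
    ('o, 'm, 't) classified, ('o, 'm, 't) classified_mor) functor_maps" where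
  "relabel S P T =
     \<lparr>fob = restrict T S,
      fmor = (\<lambda>(X, F, Y) \<in> Mor (classified_cat S P). (T X, F, T Y))\<rparr>"

lemma fob_relabel: "X \<in> S \<Longrightarrow> fob (relabel S P T) X = T X"
  by (simp add: relabel_def)

lemma fmor_relabel:
  "(X, F, Y) \<in> Mor (classified_cat S P) \<Longrightarrow> fmor (relabel S P T) (X, F, Y) = (T X, F, T Y)"
  by (simp add: relabel_def)

lemma relabel_is_functor:
  assumes A: "admissible S P" and A': "admissible S' P'"
    and T: "\<And>X. X \<in> S \<Longrightarrow> T X \<in> S'" and fst: "\<And>X. fst (T X) = fst X"
    and mor: "\<And>X F Y. (X, F, Y) \<in> Mor (classified_cat S P) \<Longrightarrow> P' (T X) (T Y) F"
  shows "is_functor (classified_cat S P) (classified_cat S' P') (relabel S P T)"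
proof -
  let ?C = "classified_cat S P" and ?D = "classified_cat S' P'"
  have m: "(T X, F, T Y) \<in> Mor ?D" if "(X, F, Y) \<in> Mor ?C" for X F Y
    using mor[OF that] that T by (simp add: Mor_classified_cat fst)
  have ob: "X \<in> S" "Y \<in> S" if "(X, F, Y) \<in> Mor ?C" for X F Y
    using that by (auto simp: Mor_classified_cat)
  have id: "(X, id_functor (fst X), X) \<in> Mor ?C" if "X \<in> S" for X
    using A that id_functor_is_functor unfolding Mor_classified_cat admissible_def by blast
  have "fob (relabel S P T) \<in> Ob ?C \<rightarrow>\<^sub>E Ob ?D"
    using T by (simp add: relabel_def)
  moreover have "fmor (relabel S P T) \<in> Mor ?C \<rightarrow>\<^sub>E Mor ?D"
    using m by (auto simp: relabel_def)
  moreover have "\<forall>f\<in>Mor ?C. sc ?D (fmor (relabel S P T) f) = fob (relabel S P T) (sc ?C f) \<and>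
      tg ?D (fmor (relabel S P T) f) = fob (relabel S P T) (tg ?C f)"
    using m ob
    by (auto simp: fmor_relabel fob_relabel sc_classified_cat tg_classified_cat)
  moreover have "\<forall>X\<in>Ob ?C. fmor (relabel S P T) (idt ?C X) = idt ?D (fob (relabel S P T) X)"
    using T by (simp add: idt_classified_cat fob_relabel fmor_relabel id fst)
  moreover have "\<forall>f g. composable ?C g f \<longrightarrow>
      fmor (relabel S P T) (cmp ?C g f) =
      cmp ?D (fmor (relabel S P T) g) (fmor (relabel S P T) f)"
    using m by (auto simp: composable_classified_cat cmp_classified_cat fmor_relabel
        comp_functor_in_Mor[OF A] fst)
  ultimately show ?thesis
    unfolding is_functor_def
    using classified_cat_is_category[OF A] classified_cat_is_category[OF A'] by blast
qed

text \<open>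
  Relabellings satisfying the transposition rule \<open>P' (T X) Y F \<longleftrightarrow> P X (U Y) F\<close> form an adjunction
  whose bijections of hom-sets change the recorded source and target of a functor and nothing
  else; both sides of the naturality square are then the same composite of underlying functors.
\<close>

lemma relabel_right_adjoint:
  assumes A: "admissible S P" and A': "admissible S' P'"
    and T: "\<And>X. X \<in> S \<Longrightarrow> T X \<in> S'" and fstT: "\<And>X. fst (T X) = fst X"
    and U: "\<And>Y. Y \<in> S' \<Longrightarrow> U Y \<in> S" and fstU: "\<And>Y. fst (U Y) = fst Y"
    and morT: "\<And>X F Y. (X, F, Y) \<in> Mor (classified_cat S P) \<Longrightarrow> P' (T X) (T Y) F"
    and morU: "\<And>X F Y. (X, F, Y) \<in> Mor (classified_cat S' P') \<Longrightarrow> P (U X) (U Y) F"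
    and adj: "\<And>X Y F. X \<in> S \<Longrightarrow> Y \<in> S' \<Longrightarrow> is_functor (fst X) (fst Y) F \<Longrightarrow>
        P' (T X) Y F \<longleftrightarrow> P X (U Y) F"
  shows "is_right_adjoint (classified_cat S P) (classified_cat S' P')
    (relabel S P T) (relabel S' P' U)"
proof -
  let ?A = "classified_cat S P" and ?B = "classified_cat S' P'"
  let ?N = "relabel S P T" and ?R = "relabel S' P' U"
  define \<phi> where "\<phi> = (\<lambda>X Y (f :: ('a, 'b, 'd) classified_mor).
    (X :: ('a, 'b, 'c) classified, fst (snd f), U Y))"
  have N: "is_functor ?A ?B ?N" by (rule relabel_is_functor[OF A A' T fstT morT])
  have R: "is_functor ?B ?A ?R" by (rule relabel_is_functor[OF A' A U fstU morU])
  have transpose: "(T X, F, Y) \<in> Mor ?B \<longleftrightarrow> (X, F, U Y) \<in> Mor ?A"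
    if "X \<in> S" "Y \<in> S'" for X F Y
    using that adj[OF that] T U by (auto simp: Mor_classified_cat fstT fstU)
  have "bij_betw (\<phi> X Y) (Hom ?B (fob ?N X) Y) (Hom ?A X (fob ?R Y))"
    if XY: "X \<in> S" "Y \<in> S'" for X Y
    by (rule bij_betw_byWitness[where f' = "\<lambda>f. (T X, fst (snd f), Y)"])
      (auto simp: \<phi>_def Hom_classified_cat fob_relabel XY transpose)
  moreover have "\<phi> X' Y' (cmp ?B k (cmp ?B f (fmor ?N h))) =
      cmp ?A (fmor ?R k) (cmp ?A (\<phi> X Y f) h)"
    if ob: "X \<in> S" "Y \<in> S'" "X' \<in> S" "Y' \<in> S'"
      and h: "h \<in> Hom ?A X' X" and k: "k \<in> Hom ?B Y Y'" and f: "f \<in> Hom ?B (fob ?N X) Y"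
    for X Y X' Y' h k f
  proof -
    obtain H where h: "h = (X', H, X)" and hm: "(X', H, X) \<in> Mor ?A"
      using h by (auto simp: Hom_classified_cat)
    obtain K where k: "k = (Y, K, Y')" and km: "(Y, K, Y') \<in> Mor ?B"
      using k by (auto simp: Hom_classified_cat)
    obtain F where f: "f = (T X, F, Y)" and fm: "(T X, F, Y) \<in> Mor ?B"
      using f ob by (auto simp: Hom_classified_cat fob_relabel)
    have Nh: "(T X', H, T X) \<in> Mor ?B"
      using is_functorD(6)[OF N hm] by (simp add: fmor_relabel hm)
    have Rk: "(U Y, K, U Y') \<in> Mor ?A"
      using is_functorD(6)[OF R km] by (simp add: fmor_relabel km)
    have tf: "(X, F, U Y) \<in> Mor ?A" using fm ob by (simp add: transpose)
    have "is_functor (fst X') (fst X) H" using hm by (simp add: Mor_classified_cat)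
    then show ?thesis
      unfolding h k f using hm km fm Nh Rk tf
      by (simp add: \<phi>_def fmor_relabel cmp_classified_cat fstT
          comp_functor_in_Mor[OF A] comp_functor_in_Mor[OF A'] comp_functor_assoc)
  qed
  ultimately show ?thesis
    unfolding is_right_adjoint_def using N R by (intro conjI exI[of _ \<phi>]) auto
qed


section \<open>Congruences and functors\<close>

lemma riguet_congruenceD:
  assumes "riguet_congruence C \<Phi>"
  shows "equiv (Ob C) (rob \<Phi>)"
    and "(f, f') \<in> rfl \<Phi> a b a' b' \<Longrightarrow>
      (a, a') \<in> rob \<Phi> \<and> (b, b') \<in> rob \<Phi> \<and> f \<in> Hom C a b \<and> f' \<in> Hom C a' b'"
    and "(a, a') \<in> rob \<Phi> \<Longrightarrow> (b, b') \<in> rob \<Phi> \<Longrightarrow> f \<in> Hom C a b \<Longrightarrow>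
      \<exists>f'\<in>Hom C a' b'. (f, f') \<in> rfl \<Phi> a b a' b'"
proof -
  show "equiv (Ob C) (rob \<Phi>)" using assms unfolding riguet_congruence_def by (elim conjE)
  show "(f, f') \<in> rfl \<Phi> a b a' b' \<Longrightarrow>
      (a, a') \<in> rob \<Phi> \<and> (b, b') \<in> rob \<Phi> \<and> f \<in> Hom C a b \<and> f' \<in> Hom C a' b'"
    using assms[unfolded riguet_congruence_def, THEN conjunct2, THEN conjunct1]
      assms[unfolded riguet_congruence_def, THEN conjunct2, THEN conjunct2, THEN conjunct1]
    by blast
  have "\<forall>a b a' b'. (a, a') \<in> rob \<Phi> \<and> (b, b') \<in> rob \<Phi> \<longrightarrow>
        (\<forall>f\<in>Hom C a b. \<exists>f'\<in>Hom C a' b'. (f, f') \<in> rfl \<Phi> a b a' b')"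
    using assms unfolding riguet_congruence_def by (elim conjE)
  then show "(a, a') \<in> rob \<Phi> \<Longrightarrow> (b, b') \<in> rob \<Phi> \<Longrightarrow> f \<in> Hom C a b \<Longrightarrow>
      \<exists>f'\<in>Hom C a' b'. (f, f') \<in> rfl \<Phi> a b a' b'"
    by blast
qed

lemma generalized_congruenceD:
  assumes "generalized_congruence C \<Psi>"
  shows "equiv (Ob C) (gob \<Psi>)" and "equiv (Mor_plus C (gob \<Psi>)) (gfl \<Psi>)"
    and "(a, b) \<in> gob \<Psi> \<Longrightarrow> ([idt C a], [idt C b]) \<in> gfl \<Psi>"
    and "(fs, gs) \<in> gfl \<Psi> \<Longrightarrow> (sc C (hd fs), sc C (hd gs)) \<in> gob \<Psi>"
    and "(fs, gs) \<in> gfl \<Psi> \<Longrightarrow> (tg C (last fs), tg C (last gs)) \<in> gob \<Psi>"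
    and "composable C g f \<Longrightarrow> ([f, g], [cmp C g f]) \<in> gfl \<Psi>"
    and "(fs, fs') \<in> gfl \<Psi> \<Longrightarrow> (gs, gs') \<in> gfl \<Psi> \<Longrightarrow>
      (tg C (last fs), sc C (hd gs)) \<in> gob \<Psi> \<Longrightarrow> (fs @ gs, fs' @ gs') \<in> gfl \<Psi>"
  using assms unfolding generalized_congruence_def composable_def by auto

lemma equivD:
  assumes "equiv A r"
  shows "(x, y) \<in> r \<Longrightarrow> x \<in> A \<and> y \<in> A" and "x \<in> A \<Longrightarrow> (x, x) \<in> r"
    and "(x, y) \<in> r \<Longrightarrow> (y, x) \<in> r" and "(x, y) \<in> r \<Longrightarrow> (y, z) \<in> r \<Longrightarrow> (x, z) \<in> r"
  using assms unfolding equiv_def by (auto dest: refl_onD symD transD)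

lemma Mor_plusD:
  assumes "fs \<in> Mor_plus C E"
  shows "fs \<noteq> []" and "set fs \<subseteq> Mor C" and "hd fs \<in> Mor C" and "last fs \<in> Mor C"
  using assms unfolding Mor_plus_def by auto

lemma Mor_plus_append:
  assumes fs: "fs \<in> Mor_plus C E" and gs: "gs \<in> Mor_plus C E"
    and link: "(tg C (last fs), sc C (hd gs)) \<in> E"
  shows "fs @ gs \<in> Mor_plus C E"
proof -
  have "(tg C ((fs @ gs) ! i), sc C ((fs @ gs) ! Suc i)) \<in> E"
    if i: "Suc i < length (fs @ gs)" for i
  proof -
    consider "Suc i < length fs" | "Suc i = length fs" | "length fs \<le> i" by linarith
    then show ?thesis
    proof cases
      case 1
      then show ?thesis using fs by (simp add: Mor_plus_def nth_append)
    next
      case 2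
      have "gs \<noteq> []" "fs \<noteq> []" using Mor_plusD(1) fs gs by auto
      moreover have "i = length fs - 1" using 2 by simp
      ultimately show ?thesis using 2 link
        by (simp add: nth_append last_conv_nth hd_conv_nth)
    next
      case 3
      then have "Suc (i - length fs) < length gs" using i by auto
      then have "(tg C (gs ! (i - length fs)), sc C (gs ! Suc (i - length fs))) \<in> E"
        using gs by (simp add: Mor_plus_def)
      then show ?thesis using 3 by (simp add: nth_append Suc_diff_le)
    qed
  qed
  then show ?thesis using fs gs by (auto simp: Mor_plus_def)
qed

lemma Mor_plus_single [simp]: "[f] \<in> Mor_plus C E \<longleftrightarrow> f \<in> Mor C"
  by (simp add: Mor_plus_def)

lemma Mor_plus_pair:
  "[f, g] \<in> Mor_plus C E \<longleftrightarrow> f \<in> Mor C \<and> g \<in> Mor C \<and> (tg C f, sc C g) \<in> E"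
  by (auto simp: Mor_plus_def less_Suc_eq)

lemma riguet_morphism_iff:
  "riguet_morphism (C, \<Phi>) (D, \<Upsilon>) F \<longleftrightarrow>
     (\<forall>a b. (a, b) \<in> rob \<Phi> \<longrightarrow> (fob F a, fob F b) \<in> rob \<Upsilon>) \<and>
     (\<forall>a b a' b' f f'. (f, f') \<in> rfl \<Phi> a b a' b' \<longrightarrow>
        (fmor F f, fmor F f') \<in> rfl \<Upsilon> (fob F a) (fob F b) (fob F a') (fob F b'))"
  by (simp add: riguet_morphism_def)

lemma gencong_morphism_iff:
  "gencong_morphism (C, \<Psi>) (D, \<Omega>) F \<longleftrightarrow>
     (\<forall>a b. (a, b) \<in> gob \<Psi> \<longrightarrow> (fob F a, fob F b) \<in> gob \<Omega>) \<and>
     (\<forall>fs gs. (fs, gs) \<in> gfl \<Psi> \<longrightarrow> (map (fmor F) fs, map (fmor F) gs) \<in> gfl \<Omega>)"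
  by (simp add: gencong_morphism_def)

lemma riguet_Ob:
  assumes R: "riguet_congruence C \<Phi>"
  shows "(a, b) \<in> rob \<Phi> \<Longrightarrow> a \<in> Ob C \<and> b \<in> Ob C"
    and "(f, f') \<in> rfl \<Phi> a b a' b' \<Longrightarrow>
      a \<in> Ob C \<and> b \<in> Ob C \<and> a' \<in> Ob C \<and> b' \<in> Ob C \<and> f \<in> Mor C \<and> f' \<in> Mor C"
  using equivD(1)[OF riguet_congruenceD(1)[OF R]] riguet_congruenceD(2)[OF R]
  unfolding Hom_def by blast+

lemma gencong_Ob:
  assumes G: "generalized_congruence C \<Psi>"
  shows "(a, b) \<in> gob \<Psi> \<Longrightarrow> a \<in> Ob C \<and> b \<in> Ob C"
    and "(fs, gs) \<in> gfl \<Psi> \<Longrightarrow> fs \<in> Mor_plus C (gob \<Psi>) \<and> gs \<in> Mor_plus C (gob \<Psi>)"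
  using equivD(1)[OF generalized_congruenceD(1)[OF G]]
    equivD(1)[OF generalized_congruenceD(2)[OF G]] by blast+

lemma admissible_riguet:
  "admissible {(C, \<Phi>). is_category C \<and> riguet_congruence C \<Phi>} riguet_morphism"
  by (rule admissibleI)
    (auto simp: riguet_morphism_iff id_functor_def comp_functor_def dest: riguet_Ob)

lemma admissible_gencong:
  "admissible {(C, \<Psi>). is_category C \<and> generalized_congruence C \<Psi>} gencong_morphism"
proof (rule admissibleI)
  have lists: "set fs \<subseteq> Mor C" "set gs \<subseteq> Mor C"
    if "generalized_congruence C \<Psi>" "(fs, gs) \<in> gfl \<Psi>"
    for C :: "('a, 'b) category" and \<Psi> fs gs
    using gencong_Ob(2)[OF that] Mor_plusD(2) by blast+
  fix C D E :: "('a, 'b) category" and \<Psi> \<Omega> \<Theta>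
    and F G :: "('a, 'b, 'a, 'b) functor_maps"
  assume "(C, \<Psi>) \<in> {(C, \<Psi>). is_category C \<and> generalized_congruence C \<Psi>}"
  then have g: "generalized_congruence C \<Psi>" and c: "is_category C" by auto
  show "is_category C" by (rule c)
  have "map (fmor (id_functor C)) fs = fs" if "set fs \<subseteq> Mor C" for fs
    using that by (intro map_idI) (auto simp: id_functor_def)
  then show "gencong_morphism (C, \<Psi>) (C, \<Psi>) (id_functor C)"
    using lists[OF g] gencong_Ob(1)[OF g]
    by (auto simp: gencong_morphism_iff) (auto simp: id_functor_def)
  have "map (fmor (comp_functor C G F)) fs = map (fmor G) (map (fmor F) fs)"
    if "set fs \<subseteq> Mor C" for fs
    using that by (auto simp: comp_functor_def)
  moreover have "fob (comp_functor C G F) a = fob G (fob F a)" if "a \<in> Ob C" for a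
    using that by (simp add: comp_functor_def)
  ultimately show "gencong_morphism (C, \<Psi>) (E, \<Theta>) (comp_functor C G F)"
    if "gencong_morphism (C, \<Psi>) (D, \<Omega>) F" "gencong_morphism (D, \<Omega>) (E, \<Theta>) G"
    using that lists[OF g] gencong_Ob(1)[OF g]
    unfolding gencong_morphism_iff by (intro conjI allI impI; metis)
qed


section \<open>The natural congruence\<close>

text \<open>
  The largest generalized congruence with object part \<open>E\<close>: only the endpoints of a sequence
  matter. It bounds the object part of natural congruences from above.
\<close>

definition coarse_cong :: "('o, 'm) category \<Rightarrow> ('o \<times> 'o) set \<Rightarrow> ('o, 'm) gencong" where
  "coarse_cong C E =
     \<lparr>gob = E,
      gfl = {(fs, gs) \<in> Mor_plus C E \<times> Mor_plus C E.
        (sc C (hd fs), sc C (hd gs)) \<in> E \<and> (tg C (last fs), tg C (last gs)) \<in> E}\<rparr>"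

lemma coarse_cong_is_generalized_congruence:
  assumes C: "is_category C" and E: "equiv (Ob C) E"
  shows "generalized_congruence C (coarse_cong C E)"
proof -
  note c = is_categoryD[OF C] and e = equivD[OF E]
  have i: "idt C a \<in> Mor C" "sc C (idt C a) = a" "tg C (idt C a) = a" if "a \<in> Ob C" for a
    using c(3)[OF that] by (auto simp: Hom_def)
  have m: "cmp C g f \<in> Mor C" "sc C (cmp C g f) = sc C f" "tg C (cmp C g f) = tg C g"
    if "f \<in> Mor C" "g \<in> Mor C" "sc C g = tg C f" for f g
    using c(4)[of g f] that by (auto simp: Hom_def composable_def)
  have "equiv (Mor_plus C E) (gfl (coarse_cong C E))"
  proof (rule equivI)
    show "refl_on (Mor_plus C E) (gfl (coarse_cong C E))"
      by (rule refl_onI) (auto simp: coarse_cong_def intro!: e(2) c(1,2) dest: Mor_plusD)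
    show "gfl (coarse_cong C E) \<subseteq> Mor_plus C E \<times> Mor_plus C E"
      by (auto simp: coarse_cong_def)
    show "sym (gfl (coarse_cong C E))"
      by (rule symI) (auto simp: coarse_cong_def intro: e(3))
    show "trans (gfl (coarse_cong C E))"
      by (rule transI) (auto simp: coarse_cong_def intro: e(4))
  qed
  moreover have "(fs @ gs, fs' @ gs') \<in> gfl (coarse_cong C E)"
    if fs: "(fs, fs') \<in> gfl (coarse_cong C E)" and gs: "(gs, gs') \<in> gfl (coarse_cong C E)"
      and link: "(tg C (last fs), sc C (hd gs)) \<in> E" for fs fs' gs gs'
  proof -
    have M: "fs \<in> Mor_plus C E" "fs' \<in> Mor_plus C E" "gs \<in> Mor_plus C E" "gs' \<in> Mor_plus C E"
      and r: "(sc C (hd fs), sc C (hd fs')) \<in> E" "(tg C (last fs), tg C (last fs')) \<in> E"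
        "(sc C (hd gs), sc C (hd gs')) \<in> E" "(tg C (last gs), tg C (last gs')) \<in> E"
      using fs gs by (auto simp: coarse_cong_def)
    have "(tg C (last fs'), sc C (hd gs')) \<in> E"
      using e(4)[OF e(4)[OF e(3)[OF r(2)] link] r(3)] .
    then have "fs @ gs \<in> Mor_plus C E" "fs' @ gs' \<in> Mor_plus C E"
      using M link by (auto intro: Mor_plus_append)
    then show ?thesis
      using r Mor_plusD(1)[OF M(1)] Mor_plusD(1)[OF M(2)] Mor_plusD(1)[OF M(3)]
        Mor_plusD(1)[OF M(4)]
      by (simp add: coarse_cong_def)
  qed
  moreover have "([idt C a], [idt C b]) \<in> gfl (coarse_cong C E)" if "(a, b) \<in> E" for a b
    using that e(1)[OF that] by (simp add: coarse_cong_def i)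
  moreover have "([f, g], [cmp C g f]) \<in> gfl (coarse_cong C E)"
    if "f \<in> Mor C" "g \<in> Mor C" "sc C g = tg C f" for f g
    using that m[OF that] by (simp add: coarse_cong_def Mor_plus_pair c e(2))
  moreover have "gob (coarse_cong C E) = E" by (simp add: coarse_cong_def)
  moreover have "(sc C (hd fs), sc C (hd gs)) \<in> E \<and> (tg C (last fs), tg C (last gs)) \<in> E"
    if "(fs, gs) \<in> gfl (coarse_cong C E)" for fs gs
    using that by (simp add: coarse_cong_def)
  ultimately show ?thesis
    unfolding generalized_congruence_def using E by simp
qed

lemma natural_cong_properties:
  assumes "is_category C" and "riguet_congruence C \<Phi>"
  shows "generalized_congruence C (natural_cong C \<Phi>)"
    and "rob \<Phi> \<subseteq> gob (natural_cong C \<Phi>)"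
    and "(f, f') \<in> rfl \<Phi> a b a' b' \<Longrightarrow> ([f], [f']) \<in> gfl (natural_cong C \<Phi>)"
    and "contains_riguet C \<Phi> \<Psi> \<Longrightarrow>
      gob (natural_cong C \<Phi>) \<subseteq> gob \<Psi> \<and> gfl (natural_cong C \<Phi>) \<subseteq> gfl \<Psi>"
proof -
  have s: "smallest_containing C \<Phi> (natural_cong C \<Phi>)"
    by (rule natural_cong_smallest[OF assms])
  then show "generalized_congruence C (natural_cong C \<Phi>)"
    and "rob \<Phi> \<subseteq> gob (natural_cong C \<Phi>)"
    unfolding smallest_containing_def contains_riguet_def by blast+
  show "(f, f') \<in> rfl \<Phi> a b a' b' \<Longrightarrow> ([f], [f']) \<in> gfl (natural_cong C \<Phi>)"
    using s riguet_congruenceD(2)[OF assms(2)]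
    unfolding smallest_containing_def contains_riguet_def by blast
  show "contains_riguet C \<Phi> \<Psi> \<Longrightarrow>
      gob (natural_cong C \<Phi>) \<subseteq> gob \<Psi> \<and> gfl (natural_cong C \<Phi>) \<subseteq> gfl \<Psi>"
    using s unfolding smallest_containing_def by blast
qed

text \<open>
  Closing up under the axioms on sequences never forces new identifications of objects, because the coarse
  congruence with object part \<open>rob \<Phi>\<close> already contains \<open>\<Phi>\<close>.
\<close>

lemma gob_natural_cong:
  assumes C: "is_category C" and R: "riguet_congruence C \<Phi>"
  shows "gob (natural_cong C \<Phi>) = rob \<Phi>"
proof
  note R' = riguet_congruenceD[OF R]
  have "contains_riguet C \<Phi> (coarse_cong C (rob \<Phi>))"
    unfolding contains_riguet_def
    using coarse_cong_is_generalized_congruence[OF C R'(1)]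
    by (auto simp: coarse_cong_def Hom_def dest!: R'(2))
  from natural_cong_properties(4)[OF C R this]
  show "gob (natural_cong C \<Phi>) \<subseteq> rob \<Phi>" by (simp add: coarse_cong_def)
qed (rule natural_cong_properties(2)[OF C R])

text \<open>
  Since natural identifies no further objects, the lifting axiom for \<open>\<Phi>\<close> applies to every
  instance required here.
\<close>

lemma strong_natural_cong:
  assumes C: "is_category C" and R: "riguet_congruence C \<Phi>"
  shows "strong C (natural_cong C \<Phi>)"
  unfolding strong_def gob_natural_cong[OF assms]
  using riguet_congruenceD(3)[OF R] natural_cong_properties(3)[OF C R] by blast

definition pullback_cong ::
  "('o, 'm) category \<Rightarrow> ('o, 'm, 'p, 'n) functor_maps \<Rightarrow> ('p, 'n) gencong \<Rightarrow> ('o, 'm) gencong" where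
  "pullback_cong C F \<Omega> =
     (let E = {(a, b) \<in> Ob C \<times> Ob C. (fob F a, fob F b) \<in> gob \<Omega>} in
      \<lparr>gob = E,
       gfl = {(fs, gs) \<in> Mor_plus C E \<times> Mor_plus C E.
         (map (fmor F) fs, map (fmor F) gs) \<in> gfl \<Omega>}\<rparr>)"

lemma gob_pullback_cong:
  "(a, b) \<in> gob (pullback_cong C F \<Omega>) \<longleftrightarrow>
     a \<in> Ob C \<and> b \<in> Ob C \<and> (fob F a, fob F b) \<in> gob \<Omega>"
  by (simp add: pullback_cong_def Let_def)

lemma gfl_pullback_cong:
  "(fs, gs) \<in> gfl (pullback_cong C F \<Omega>) \<longleftrightarrow>
     fs \<in> Mor_plus C (gob (pullback_cong C F \<Omega>)) \<and> gs \<in> Mor_plus C (gob (pullback_cong C F \<Omega>)) \<and>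
     (map (fmor F) fs, map (fmor F) gs) \<in> gfl \<Omega>"
  by (simp add: pullback_cong_def Let_def)

lemma map_functor_Mor_plus:
  assumes F: "is_functor C D F" and fs: "fs \<in> Mor_plus C (gob (pullback_cong C F \<Omega>))"
  shows "map (fmor F) fs \<in> Mor_plus D (gob \<Omega>)"
proof -
  note f = is_functorD[OF F]
  have m: "fs ! i \<in> Mor C" if "i < length fs" for i
    using Mor_plusD(2)[OF fs] that by (auto simp: subset_iff)
  show ?thesis
    using fs by (auto simp: Mor_plus_def gob_pullback_cong f(6) f(7,8)[OF m])
qed

lemma pullback_cong_is_generalized_congruence:
  assumes F: "is_functor C D F" and G: "generalized_congruence D \<Omega>"
  shows "generalized_congruence C (pullback_cong C F \<Omega>)"
proof -
  note f = is_functorD[OF F] and g = generalized_congruenceD[OF G]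
  note e = equivD[OF g(1)] and e' = equivD[OF g(2)] and c = is_categoryD[OF f(1)]
  let ?\<Psi> = "pullback_cong C F \<Omega>"
  have i: "idt C a \<in> Mor C" if "a \<in> Ob C" for a
    using c(3)[OF that] by (auto simp: Hom_def)
  have E: "equiv (Ob C) (gob ?\<Psi>)"
    by (rule equivI)
      (auto simp: refl_on_def sym_def trans_def gob_pullback_cong e(2) f(5) intro: e(3,4))
  moreover have "equiv (Mor_plus C (gob ?\<Psi>)) (gfl ?\<Psi>)"
    by (rule equivI)
      (auto simp: refl_on_def sym_def trans_def gfl_pullback_cong
        intro: e'(3,4) e'(2)[OF map_functor_Mor_plus[OF F]])
  moreover have "([idt C a], [idt C b]) \<in> gfl ?\<Psi>" if "(a, b) \<in> gob ?\<Psi>" for a b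
    using that by (auto simp: gfl_pullback_cong gob_pullback_cong i f(9) g(3))
  moreover have "(sc C (hd fs), sc C (hd gs)) \<in> gob ?\<Psi> \<and> (tg C (last fs), tg C (last gs)) \<in> gob ?\<Psi>"
    if "(fs, gs) \<in> gfl ?\<Psi>" for fs gs
  proof -
    have fg: "fs \<in> Mor_plus C (gob ?\<Psi>)" "gs \<in> Mor_plus C (gob ?\<Psi>)"
      and r: "(map (fmor F) fs, map (fmor F) gs) \<in> gfl \<Omega>"
      using that by (auto simp: gfl_pullback_cong)
    note fs = Mor_plusD[OF fg(1)] and gs = Mor_plusD[OF fg(2)]
    show ?thesis
      using g(4)[OF r] g(5)[OF r] fs gs
      by (simp add: gob_pullback_cong hd_map last_map f(7,8) c(1,2))
  qed
  moreover have "([h, k], [cmp C k h]) \<in> gfl ?\<Psi>"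
    if "h \<in> Mor C" "k \<in> Mor C" "sc C k = tg C h" for h k
  proof -
    have hk: "composable C k h" using that by (simp add: composable_def)
    have "cmp C k h \<in> Mor C" using c(4)[OF hk] by (simp add: Hom_def)
    moreover have "(tg C h, tg C h) \<in> gob ?\<Psi>" using equivD(2)[OF E] c(2) that by blast
    ultimately show ?thesis
      using that g(6)[OF functor_composable[OF F hk]]
      by (simp add: gfl_pullback_cong Mor_plus_pair f(10)[OF hk])
  qed
  moreover have "(fs @ gs, fs' @ gs') \<in> gfl ?\<Psi>"
    if fs: "(fs, fs') \<in> gfl ?\<Psi>" and gs: "(gs, gs') \<in> gfl ?\<Psi>"
      and link: "(tg C (last fs), sc C (hd gs)) \<in> gob ?\<Psi>"
      and ends: "(tg C (last fs), tg C (last fs')) \<in> gob ?\<Psi>"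
        "(sc C (hd gs), sc C (hd gs')) \<in> gob ?\<Psi>" for fs fs' gs gs'
  proof -
    have M: "fs \<in> Mor_plus C (gob ?\<Psi>)" "fs' \<in> Mor_plus C (gob ?\<Psi>)"
      "gs \<in> Mor_plus C (gob ?\<Psi>)" "gs' \<in> Mor_plus C (gob ?\<Psi>)"
      and r: "(map (fmor F) fs, map (fmor F) fs') \<in> gfl \<Omega>"
        "(map (fmor F) gs, map (fmor F) gs') \<in> gfl \<Omega>"
      using fs gs by (auto simp: gfl_pullback_cong)
    have "(tg C (last fs'), sc C (hd gs')) \<in> gob ?\<Psi>"
      using equivD(4)[OF E equivD(4)[OF E equivD(3)[OF E ends(1)] link] ends(2)] .
    then have "fs @ gs \<in> Mor_plus C (gob ?\<Psi>)" "fs' @ gs' \<in> Mor_plus C (gob ?\<Psi>)"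
      using M link by (auto intro: Mor_plus_append)
    moreover have "(tg D (last (map (fmor F) fs)), sc D (hd (map (fmor F) gs))) \<in> gob \<Omega>"
      using link Mor_plusD[OF M(1)] Mor_plusD[OF M(3)]
      by (simp add: gob_pullback_cong hd_map last_map f(7,8))
    ultimately show ?thesis
      using g(7)[OF r] by (simp add: gfl_pullback_cong)
  qed
  ultimately show ?thesis
    unfolding generalized_congruence_def by blast
qed

text \<open>
  The universal property of natural: the pairs of objects and of sequences that \<open>F\<close> sends into
  \<open>\<Omega>\<close> form a generalized congruence, the pullback of \<open>\<Omega>\<close>. If this contains the generating pairs
  from \<open>\<Phi>\<close>, it contains the natural congruence by minimality.
\<close>

lemma gencong_morphism_natural_iff:
  assumes F: "is_functor C D F" and R: "riguet_congruence C \<Phi>"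
    and G: "generalized_congruence D \<Omega>"
  shows "gencong_morphism (C, natural_cong C \<Phi>) (D, \<Omega>) F \<longleftrightarrow>
    (\<forall>a b. (a, b) \<in> rob \<Phi> \<longrightarrow> (fob F a, fob F b) \<in> gob \<Omega>) \<and>
    (\<forall>a b a' b' f f'. (f, f') \<in> rfl \<Phi> a b a' b' \<longrightarrow> ([fmor F f], [fmor F f']) \<in> gfl \<Omega>)"
    (is "?L \<longleftrightarrow> ?R")
proof
  note N = natural_cong_properties[OF is_functorD(1)[OF F] R]
  show ?R if ?L
    using that N(2,3) unfolding gencong_morphism_iff by fastforce
  assume ?R
  then have "contains_riguet C \<Phi> (pullback_cong C F \<Omega>)"
    unfolding contains_riguet_def
    using pullback_cong_is_generalized_congruence[OF F G] riguet_Ob[OF R]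
    by (auto simp: gob_pullback_cong gfl_pullback_cong)
  from N(4)[OF this] show ?L
    by (auto simp: gencong_morphism_iff gob_pullback_cong gfl_pullback_cong subset_iff)
qed


section \<open>The flat congruence\<close>

lemma rob_flat_cong [simp]: "rob (flat_cong C \<Psi>) = gob \<Psi>"
  by (simp add: flat_cong_def)

lemma rfl_flat_cong:
  "(f, f') \<in> rfl (flat_cong C \<Psi>) a b a' b' \<longleftrightarrow>
     (a, a') \<in> gob \<Psi> \<and> (b, b') \<in> gob \<Psi> \<and> f \<in> Hom C a b \<and> f' \<in> Hom C a' b' \<and>
     ([f], [f']) \<in> gfl \<Psi>"
  by (auto simp: flat_cong_def)

text \<open>
  Closure under composition is the only axiom that needs longer sequences: related pairs may be
  concatenated, and \<open>[f, g]\<close> is related to \<open>[cmp C g f]\<close>. The lifting axiom is strength.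
\<close>

lemma flat_cong_is_riguet_congruence:
  assumes C: "is_category C" and G: "generalized_congruence C \<Psi>" and S: "strong C \<Psi>"
  shows "riguet_congruence C (flat_cong C \<Psi>)"
proof -
  note c = is_categoryD[OF C] and g = generalized_congruenceD[OF G]
  note e = equivD[OF g(1)] and e' = equivD[OF g(2)]
  let ?\<Phi> = "flat_cong C \<Psi>"
  have "(idt C a, idt C b) \<in> rfl ?\<Phi> a a b b" if "(a, b) \<in> gob \<Psi>" for a b
    using that e(1)[OF that] by (auto simp: rfl_flat_cong c(3) g(3))
  moreover have "(f, f) \<in> rfl ?\<Phi> a b a b" if "a \<in> Ob C" "b \<in> Ob C" "f \<in> Hom C a b" for a b f
    using that by (auto simp: rfl_flat_cong Hom_def intro: e(2) e'(2))
  moreover have "(f', f) \<in> rfl ?\<Phi> a' b' a b" if "(f, f') \<in> rfl ?\<Phi> a b a' b'" for f f' a b a' b'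
    using that by (auto simp: rfl_flat_cong intro: e(3) e'(3))
  moreover have "(f, f'') \<in> rfl ?\<Phi> a b a'' b''"
    if "(f, f') \<in> rfl ?\<Phi> a b a' b'" "(f', f'') \<in> rfl ?\<Phi> a' b' a'' b''"
    for f f' f'' a b a' b' a'' b''
    using that by (auto simp: rfl_flat_cong intro: e(4) e'(4))
  moreover have "(cmp C k h, cmp C k' h') \<in> rfl ?\<Phi> a d a' d'"
    if "(h, h') \<in> rfl ?\<Phi> a b a' b'" "(k, k') \<in> rfl ?\<Phi> b d b' d'" for h h' k k' a b d a' b' d'
  proof -
    have ob: "(a, a') \<in> gob \<Psi>" "(b, b') \<in> gob \<Psi>" "(d, d') \<in> gob \<Psi>"
      and hom: "h \<in> Hom C a b" "h' \<in> Hom C a' b'" "k \<in> Hom C b d" "k' \<in> Hom C b' d'"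
      and r: "([h], [h']) \<in> gfl \<Psi>" "([k], [k']) \<in> gfl \<Psi>"
      using that by (auto simp: rfl_flat_cong)
    have m: "composable C k h" "composable C k' h'"
      using hom by (auto simp: composable_def Hom_def)
    have "(tg C h, sc C k) \<in> gob \<Psi>" using hom e(1,2) ob by (auto simp: Hom_def)
    then have "([h, k], [h', k']) \<in> gfl \<Psi>" using g(7)[OF r] by simp
    then have "([cmp C k h], [cmp C k' h']) \<in> gfl \<Psi>"
      using e'(4)[OF e'(4)[OF e'(3)[OF g(6)[OF m(1)]]] g(6)[OF m(2)]] by blast
    then show ?thesis
      using ob hom c(4)[OF m(1)] c(4)[OF m(2)] by (simp add: rfl_flat_cong Hom_def)
  qed
  moreover have "\<exists>f'\<in>Hom C a' b'. (f, f') \<in> rfl ?\<Phi> a b a' b'"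
    if "(a, a') \<in> gob \<Psi>" "(b, b') \<in> gob \<Psi>" "f \<in> Hom C a b" for a b a' b' f
    using S that unfolding strong_def rfl_flat_cong by blast
  moreover have "rfl ?\<Phi> a b a' b' \<subseteq> Hom C a b \<times> Hom C a' b'" for a b a' b'
    by (auto simp: rfl_flat_cong)
  moreover have "rfl ?\<Phi> a b a' b' = {}" if "\<not> ((a, a') \<in> gob \<Psi> \<and> (b, b') \<in> gob \<Psi>)"
    for a b a' b'
    using that by (auto simp: flat_cong_def)
  ultimately show ?thesis
    using g(1) unfolding riguet_congruence_def rob_flat_cong
    by (intro conjI allI ballI impI; (elim conjE)?; metis)
qed

text \<open>
  The condition on the right is the same as in \<open>gencong_morphism_natural_iff\<close>; this coincidence
  is the whole content of the adjunction. Of the conditions that put a pair into a component of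
  flat, membership in the hom-sets is automatic for the image under a functor, and relatedness of
  the end objects is the first conjunct applied to the index of the component.
\<close>

lemma riguet_morphism_flat_iff:
  assumes F: "is_functor C D F" and R: "riguet_congruence C \<Phi>"
  shows "riguet_morphism (C, \<Phi>) (D, flat_cong D \<Omega>) F \<longleftrightarrow>
    (\<forall>a b. (a, b) \<in> rob \<Phi> \<longrightarrow> (fob F a, fob F b) \<in> gob \<Omega>) \<and>
    (\<forall>a b a' b' f f'. (f, f') \<in> rfl \<Phi> a b a' b' \<longrightarrow> ([fmor F f], [fmor F f']) \<in> gfl \<Omega>)"
  using riguet_congruenceD(2)[OF R] functor_Hom[OF F]
  unfolding riguet_morphism_iff rob_flat_cong rfl_flat_cong by meson


section \<open>The adjunction\<close>

lemma SGCCat_eq: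
  "SGCCat = classified_cat {(C, \<Psi>). is_category C \<and> generalized_congruence C \<Psi> \<and> strong C \<Psi>}
     gencong_morphism"
  unfolding SGCCat_def GCCat_def full_subcategory_classified_cat
  by (rule arg_cong[of _ _ "\<lambda>S. classified_cat S gencong_morphism"]) auto

theorem theorem2p47:
  shows "\<exists>N. is_functor (RCCat :: ('o, 'm) rccat) (GCCat :: ('o, 'm) gccat) N \<and>
     (\<forall>C \<Phi>. (C, \<Phi>) \<in> Ob (RCCat :: ('o, 'm) rccat) \<longrightarrow> fob N (C, \<Phi>) = (C, natural_cong C \<Phi>)) \<and>
     (\<forall>X F Y. (X, F, Y) \<in> Mor (RCCat :: ('o, 'm) rccat) \<longrightarrow>
        fmor N (X, F, Y) = (fob N X, F, fob N Y)) \<and>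
     fob N ` Ob (RCCat :: ('o, 'm) rccat) \<subseteq> Ob (SGCCat :: ('o, 'm) gccat) \<and>
     fmor N ` Mor (RCCat :: ('o, 'm) rccat) \<subseteq> Mor (SGCCat :: ('o, 'm) gccat) \<and>
     (\<exists>R. is_right_adjoint (RCCat :: ('o, 'm) rccat) (SGCCat :: ('o, 'm) gccat) N R \<and>
        (\<forall>C \<Psi>. (C, \<Psi>) \<in> Ob (SGCCat :: ('o, 'm) gccat) \<longrightarrow> fob R (C, \<Psi>) = (C, flat_cong C \<Psi>)) \<and>
        (\<forall>X F Y. (X, F, Y) \<in> Mor (SGCCat :: ('o, 'm) gccat) \<longrightarrow>
           fmor R (X, F, Y) = (fob R X, F, fob R Y)))"
proof -
  let ?RS = "{(C :: ('o, 'm) category, \<Phi>). is_category C \<and> riguet_congruence C \<Phi>}"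
  let ?GS = "{(C :: ('o, 'm) category, \<Psi>). is_category C \<and> generalized_congruence C \<Psi>}"
  let ?SS = "{(C :: ('o, 'm) category, \<Psi>).
    is_category C \<and> generalized_congruence C \<Psi> \<and> strong C \<Psi>}"
  define T :: "('o, 'm, ('o, 'm) riguet) classified \<Rightarrow> ('o, 'm, ('o, 'm) gencong) classified"
    where "T = (\<lambda>(C, \<Phi>). (C, natural_cong C \<Phi>))"
  define U :: "('o, 'm, ('o, 'm) gencong) classified \<Rightarrow> ('o, 'm, ('o, 'm) riguet) classified"
    where "U = (\<lambda>(C, \<Psi>). (C, flat_cong C \<Psi>))"
  let ?N = "relabel ?RS riguet_morphism T" and ?R = "relabel ?SS gencong_morphism U"
  have fstT: "fst (T X) = fst X" for X by (simp add: T_def split_beta)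
  have fstU: "fst (U Y) = fst Y" for Y by (simp add: U_def split_beta)
  have T: "T X \<in> ?SS" if "X \<in> ?RS" for X
    using that by (auto simp: T_def natural_cong_properties(1) strong_natural_cong)
  then have T': "T X \<in> ?GS" if "X \<in> ?RS" for X using that by fastforce
  have U: "U Y \<in> ?RS" if "Y \<in> ?SS" for Y
    using that by (auto simp: U_def flat_cong_is_riguet_congruence)
  have adm: "admissible ?SS gencong_morphism"
    by (rule admissible_subset[OF admissible_gencong]) auto
  have adj: "gencong_morphism (T X) Y F \<longleftrightarrow> riguet_morphism X (U Y) F"
    if "X \<in> ?RS" "Y \<in> ?SS" "is_functor (fst X) (fst Y) F" for X Y F
    using that by (auto simp: T_def U_def gencong_morphism_natural_iff riguet_morphism_flat_iff)
  have morT: "gencong_morphism (T X) (T Y) F"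
    if "(X, F, Y) \<in> Mor (classified_cat ?RS riguet_morphism)" for X F Y
  proof -
    obtain C \<Phi> D \<Upsilon> where XY: "X = (C, \<Phi>)" "Y = (D, \<Upsilon>)" by (cases X; cases Y)
    have F: "is_functor C D F" and R: "riguet_congruence C \<Phi>" "riguet_congruence D \<Upsilon>"
      and D: "is_category D" and m: "riguet_morphism (C, \<Phi>) (D, \<Upsilon>) F"
      using that unfolding XY by (auto simp: Mor_classified_cat)
    note N = natural_cong_properties[OF D R(2)]
    show ?thesis
      unfolding XY T_def using m N(2,3)
      by (simp add: gencong_morphism_natural_iff[OF F R(1) N(1)] riguet_morphism_iff) blast
  qed
  have morU: "riguet_morphism (U X) (U Y) F"
    if "(X, F, Y) \<in> Mor (classified_cat ?SS gencong_morphism)" for X F Y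
  proof -
    obtain C \<Psi> D \<Omega> where XY: "X = (C, \<Psi>)" "Y = (D, \<Omega>)" by (cases X; cases Y)
    have F: "is_functor C D F" and X: "is_category C" "generalized_congruence C \<Psi>" "strong C \<Psi>"
      and m: "gencong_morphism (C, \<Psi>) (D, \<Omega>) F"
      using that unfolding XY by (auto simp: Mor_classified_cat)
    show ?thesis
      unfolding XY U_def using m
      by (fastforce simp: riguet_morphism_flat_iff[OF F flat_cong_is_riguet_congruence[OF X]]
          gencong_morphism_iff rfl_flat_cong)
  qed
  have N: "is_functor RCCat GCCat ?N"
    unfolding RCCat_def GCCat_def
    by (rule relabel_is_functor[OF admissible_riguet admissible_gencong T' fstT morT])
  have NR: "is_right_adjoint RCCat SGCCat ?N ?R"
    unfolding RCCat_def SGCCat_eq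
    by (rule relabel_right_adjoint[OF admissible_riguet adm T fstT U fstU morT morU adj])
  then have NS: "is_functor RCCat SGCCat ?N" unfolding is_right_adjoint_def by simp
  have obN: "fob ?N X = T X" if "X \<in> Ob RCCat" for X
    using that unfolding RCCat_def by (simp add: fob_relabel)
  have obR: "fob ?R Y = U Y" if "Y \<in> Ob SGCCat" for Y
    using that unfolding SGCCat_eq by (simp add: fob_relabel)
  have mN: "fmor ?N (X, F, Y) = (fob ?N X, F, fob ?N Y)" if "(X, F, Y) \<in> Mor RCCat" for X F Y
    using that unfolding RCCat_def
    by (subst fmor_relabel) (auto simp: fob_relabel Mor_classified_cat)
  have mR: "fmor ?R (X, F, Y) = (fob ?R X, F, fob ?R Y)" if "(X, F, Y) \<in> Mor SGCCat" for X F Y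
    using that unfolding SGCCat_eq
    by (subst fmor_relabel) (auto simp: fob_relabel Mor_classified_cat)
  have "fob ?R (C, \<Psi>) = (C, flat_cong C \<Psi>)" if "(C, \<Psi>) \<in> Ob SGCCat" for C \<Psi>
    using obR[OF that] by (simp add: U_def)
  then have right: "\<exists>R. is_right_adjoint (RCCat :: ('o, 'm) rccat) (SGCCat :: ('o, 'm) gccat) ?N R \<and>
      (\<forall>C \<Psi>. (C, \<Psi>) \<in> Ob (SGCCat :: ('o, 'm) gccat) \<longrightarrow> fob R (C, \<Psi>) = (C, flat_cong C \<Psi>)) \<and>
      (\<forall>X F Y. (X, F, Y) \<in> Mor (SGCCat :: ('o, 'm) gccat) \<longrightarrow>
         fmor R (X, F, Y) = (fob R X, F, fob R Y))"
    using NR mR by (intro exI[of _ ?R]) simp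
  have "fob ?N (C, \<Phi>) = (C, natural_cong C \<Phi>)" if "(C, \<Phi>) \<in> Ob RCCat" for C \<Phi>
    using obN[OF that] by (simp add: T_def)
  moreover have "fob ?N ` Ob RCCat \<subseteq> Ob SGCCat" "fmor ?N ` Mor RCCat \<subseteq> Mor SGCCat"
    using is_functorD(5,6)[OF NS] by auto
  ultimately show ?thesis
    using N mN right by (intro exI[of _ ?N]) simp
qed

end
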